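(* Consider a transport network with graph $G=\langle V,E\rangle$, origin-destination set $OD$, path sets $P_{ij}$, incidence matrix $\Theta$, edge cost functions $\tau_e$, $e\in E$, origin and destination totals $l=\{l_i\}_{i\in O}$ and $w=\{w_j\}_{j\in D}$, and a parameter $\gamma>0$, as described in the context. The problem of finding an equilibrium of the two-stage model, i.e. a pair $(f,d)$ with $$d=d(T(t(f))),\qquad f=f(d),$$ reduces to the optimization problem $$\min_{(f,x,d):\ f=\Theta x;\ x\in X(d);\ d\in(l,w);\ d\ge 0}\ \ \sum_{e\in E}\int_0^{f_e}\tau_e(z)\,dz+\gamma\sum_{(i,j)\in OD}d_{ij}\ln d_{ij}, \qquad (\ast)$$ which is a convex optimization problem (convex objective over a convex feasible set), in the following sense: a pair $(f,d)$ is an equilibrium of the two-stage model if and only if there exists $x$ such that $(f,x,d)$ is an optimal solution of $(\ast)$.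
   Context: **Network.** $G=\langle V,E\rangle$ is a finite directed graph. $O\subseteq V$ is the set of origins, $D\subseteq V$ the set of destinations, and $OD\subseteq O\times D$ is a given set of (origin, destination) pairs. For $(i,j)\in OD$, $P_{ij}$ is the (finite) set of all paths without self-intersections (simple paths, viewed as sets of edges) in $G$ from $i$ to $j$; it is assumed nonempty. Let $P=\bigcup_{(i,j)\in OD}P_{ij}$. Put $\delta_{ep}=1$ if edge $e$ belongs to path $p$ and $\delta_{ep}=0$ otherwise, and $\Theta=\|\delta_{ep}\|_{e\in E,\,p\in P}$. **Demands (correspondences).** A demand matrix is a vector $d=\{d_{ij}\}_{(i,j)\in OD}$ of real numbers. Given numbers $l_i\ge 0$ ($i\in O$) and $w_j\ge 0$ ($j\in D$) with $\sum_{i\in O}l_i=\sum_{j\in D}w_j=1$, the notation $d\in(l,w)$ means $$\sum_{j:(i,j)\in OD}d_{ij}=l_i\ \ \forall i\in O,\qquad \sum_{i:(i,j)\in OD}d_{ij}=w_j\ \ \forall j\in D.$$ **Flows.** For a demand matrix $d\ge 0$, the set of feasible path-flow vectors is $$X(d)=\Big\{x=\{x_p\}_{p\in P}\ge 0:\ \sum_{p\in P_{ij}}x_p=d_{ij}\ \ \forall (i,j)\in OD\Big\}.$$ The edge-flow vector is $f=\{f_e\}_{e\in E}=\Theta x$, i.e. $f_e=\sum_{p\in P}\delta_{ep}x_p$. **Costs.** For each $e\in E$, $\tau_e:[0,\infty)\to[0,\infty)$ is a given continuous nondecreasing function (the cost of traversing edge $e$ when the flow on it is $f_e$). For an edge-flow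 vector $f$, $t(f)=\{\tau_e(f_e)\}_{e\in E}$. For an edge-cost vector $t=\{t_e\}_{e\in E}$, $T(t)=\{T_{ij}(t)\}_{(i,j)\in OD}$ is the matrix of shortest-path costs, $T_{ij}(t)=\min_{p\in P_{ij}}\sum_{e\in E}\delta_{ep}t_e$. **First block (entropy model for the demand matrix).** For a cost matrix $T=\{T_{ij}\}_{(i,j)\in OD}$ and the fixed $\gamma>0$, $d(T)$ denotes the solution (unique whenever the feasible set is nonempty) of $$\min_{d\in(l,w);\ d\ge 0}\ \sum_{(i,j)\in OD}d_{ij}T_{ij}+\gamma\sum_{(i,j)\in OD}d_{ij}\ln d_{ij},$$ with the convention $0\ln 0=0$. **Second block (equilibrium flow assignment).** For a demand matrix $d\ge 0$, $f=f(d)$ means that $f$ is the edge-flow component of an optimal solution $(f,x)$ of $$\min_{(f,x):\ f=\Theta x;\ x\in X(d)}\ \sum_{e\in E}\int_0^{f_e}\tau_e(z)\,dz .$$ **Equilibrium of the two-stage model.** A pair $(f,d)$ such that $d=d(T(t(f)))$ and $f=f(d)$, i.e. a fixed point of the two blocks. *)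

theory Defs
  imports
    "HOL-Analysis.Analysis"
    "HOL-Library.Function_Algebras"
    "Graph_Theory.Arc_Walk"
begin

text \<open>
  Vectors indexed by a finite set (edges, paths, origin-destination pairs) are total real-valued
  functions of which only the values on the index set matter: no condition and no objective below
  reads a value outside of it. The pointwise vector space structure on functions makes
  \<^const>\<open>convex\<close> and \<^const>\<open>convex_on\<close> applicable.
\<close>

instantiation "fun" :: (type, real_vector) real_vector
begin

definition scaleR_fun :: "real \<Rightarrow> ('a \<Rightarrow> 'b) \<Rightarrow> 'a \<Rightarrow> 'b"
  where "scaleR_fun c f = (\<lambda>a. c *\<^sub>R f a)"

instance
  by standard (simp_all add: scaleR_fun_def fun_eq_iff scaleR_add_right scaleR_add_left)

end

text \<open>
  A simple path is represented by its initial vertex together with its set of edges. The initial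
  vertex is redundant except for the paths without edges, which exist from a vertex to itself:
  the trivial paths at two different vertices are different paths although both have no edges.
\<close>

definition paths :: "('v, 'e) pre_digraph \<Rightarrow> 'v \<Rightarrow> 'v \<Rightarrow> ('v \<times> 'e set) set"
  where "paths G i j = {(i, set q) | q. pre_digraph.apath G i q j}"

definition all_paths :: "('v, 'e) pre_digraph \<Rightarrow> ('v \<times> 'v) set \<Rightarrow> ('v \<times> 'e set) set"
  where "all_paths G OD = (\<Union>(i, j)\<in>OD. paths G i j)"

definition incidence :: "'e \<Rightarrow> 'v \<times> 'e set \<Rightarrow> real"
  where "incidence e p = (if e \<in> snd p then 1 else 0)"

definition edge_flow ::
    "('v, 'e) pre_digraph \<Rightarrow> ('v \<times> 'v) set \<Rightarrow> ('v \<times> 'e set \<Rightarrow> real) \<Rightarrow> 'e \<Rightarrow> real"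
  where "edge_flow G OD x e = (\<Sum>p\<in>all_paths G OD. incidence e p * x p)"

text \<open>The set of all \<open>d \<ge> 0\<close> with \<open>d \<in> (l, w)\<close>.\<close>

definition demands ::
    "'v set \<Rightarrow> 'v set \<Rightarrow> ('v \<times> 'v) set \<Rightarrow> ('v \<Rightarrow> real) \<Rightarrow> ('v \<Rightarrow> real) \<Rightarrow> ('v \<times> 'v \<Rightarrow> real) set"
  where "demands Orig Dest OD l w =
    {d. (\<forall>i\<in>Orig. (\<Sum>j | (i, j) \<in> OD. d (i, j)) = l i) \<and>
        (\<forall>j\<in>Dest. (\<Sum>i | (i, j) \<in> OD. d (i, j)) = w j) \<and>
        (\<forall>(i, j)\<in>OD. 0 \<le> d (i, j))}"

definition path_flows ::
    "('v, 'e) pre_digraph \<Rightarrow> ('v \<times> 'v) set \<Rightarrow> ('v \<times> 'v \<Rightarrow> real) \<Rightarrow> ('v \<times> 'e set \<Rightarrow> real) set"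
  where "path_flows G OD d =
    {x. (\<forall>p\<in>all_paths G OD. 0 \<le> x p) \<and>
        (\<forall>(i, j)\<in>OD. (\<Sum>p\<in>paths G i j. x p) = d (i, j))}"

text \<open>All pairs \<open>(f, x)\<close> with \<open>f = \<Theta> x\<close> and \<open>x \<in> X(d)\<close>.\<close>

definition flow_assignments ::
    "('v, 'e) pre_digraph \<Rightarrow> ('v \<times> 'v) set \<Rightarrow> ('v \<times> 'v \<Rightarrow> real) \<Rightarrow>
      (('e \<Rightarrow> real) \<times> ('v \<times> 'e set \<Rightarrow> real)) set"
  where "flow_assignments G OD d =
    {(f, x). (\<forall>e\<in>arcs G. f e = edge_flow G OD x e) \<and> x \<in> path_flows G OD d}"

definition edge_costs :: "('e \<Rightarrow> real \<Rightarrow> real) \<Rightarrow> ('e \<Rightarrow> real) \<Rightarrow> 'e \<Rightarrow> real"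
  where "edge_costs \<tau> f e = \<tau> e (f e)"

definition shortest_costs :: "('v, 'e) pre_digraph \<Rightarrow> ('e \<Rightarrow> real) \<Rightarrow> 'v \<times> 'v \<Rightarrow> real"
  where "shortest_costs G t =
    (\<lambda>(i, j). Min ((\<lambda>p. \<Sum>e\<in>arcs G. incidence e p * t e) ` paths G i j))"

text \<open>The convention \<open>0 ln 0 = 0\<close> is automatic, since \<^term>\<open>0 * y = (0::real)\<close> for every value \<open>y\<close>.\<close>

definition entropy_term :: "('v \<times> 'v) set \<Rightarrow> ('v \<times> 'v \<Rightarrow> real) \<Rightarrow> real"
  where "entropy_term OD d = (\<Sum>(i, j)\<in>OD. d (i, j) * ln (d (i, j)))"

definition flow_potential ::
    "('v, 'e) pre_digraph \<Rightarrow> ('e \<Rightarrow> real \<Rightarrow> real) \<Rightarrow> ('e \<Rightarrow> real) \<Rightarrow> real"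
  where "flow_potential G \<tau> f = (\<Sum>e\<in>arcs G. integral {0..f e} (\<tau> e))"

text \<open>\<open>d = d(T)\<close>\<close>

definition is_entropy_demand ::
    "'v set \<Rightarrow> 'v set \<Rightarrow> ('v \<times> 'v) set \<Rightarrow> ('v \<Rightarrow> real) \<Rightarrow> ('v \<Rightarrow> real) \<Rightarrow> real \<Rightarrow>
      ('v \<times> 'v \<Rightarrow> real) \<Rightarrow> ('v \<times> 'v \<Rightarrow> real) \<Rightarrow> bool"
  where "is_entropy_demand Orig Dest OD l w \<gamma> T d \<longleftrightarrow>
    is_arg_min (\<lambda>d. (\<Sum>(i, j)\<in>OD. d (i, j) * T (i, j)) + \<gamma> * entropy_term OD d)
      (\<lambda>d. d \<in> demands Orig Dest OD l w) d"

text \<open>\<open>f = f(d)\<close>\<close>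

definition is_equilibrium_flow ::
    "('v, 'e) pre_digraph \<Rightarrow> ('v \<times> 'v) set \<Rightarrow> ('e \<Rightarrow> real \<Rightarrow> real) \<Rightarrow>
      ('v \<times> 'v \<Rightarrow> real) \<Rightarrow> ('e \<Rightarrow> real) \<Rightarrow> bool"
  where "is_equilibrium_flow G OD \<tau> d f \<longleftrightarrow>
    (\<exists>x. is_arg_min (\<lambda>(f, x). flow_potential G \<tau> f)
      (\<lambda>(f, x). (f, x) \<in> flow_assignments G OD d) (f, x))"

definition two_stage_equilibrium ::
    "('v, 'e) pre_digraph \<Rightarrow> 'v set \<Rightarrow> 'v set \<Rightarrow> ('v \<times> 'v) set \<Rightarrow> ('e \<Rightarrow> real \<Rightarrow> real) \<Rightarrow>
      ('v \<Rightarrow> real) \<Rightarrow> ('v \<Rightarrow> real) \<Rightarrow> real \<Rightarrow> ('e \<Rightarrow> real) \<Rightarrow> ('v \<times> 'v \<Rightarrow> real) \<Rightarrow> bool"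
  where "two_stage_equilibrium G Orig Dest OD \<tau> l w \<gamma> f d \<longleftrightarrow>
    is_entropy_demand Orig Dest OD l w \<gamma> (shortest_costs G (edge_costs \<tau> f)) d \<and>
    is_equilibrium_flow G OD \<tau> d f"

definition combined_feasible ::
    "('v, 'e) pre_digraph \<Rightarrow> 'v set \<Rightarrow> 'v set \<Rightarrow> ('v \<times> 'v) set \<Rightarrow> ('v \<Rightarrow> real) \<Rightarrow> ('v \<Rightarrow> real) \<Rightarrow>
      (('e \<Rightarrow> real) \<times> ('v \<times> 'e set \<Rightarrow> real) \<times> ('v \<times> 'v \<Rightarrow> real)) set"
  where "combined_feasible G Orig Dest OD l w =
    {(f, x, d). (f, x) \<in> flow_assignments G OD d \<and> d \<in> demands Orig Dest OD l w}"

definition combined_objective ::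
    "('v, 'e) pre_digraph \<Rightarrow> ('v \<times> 'v) set \<Rightarrow> ('e \<Rightarrow> real \<Rightarrow> real) \<Rightarrow> real \<Rightarrow>
      ('e \<Rightarrow> real) \<times> ('v \<times> 'e set \<Rightarrow> real) \<times> ('v \<times> 'v \<Rightarrow> real) \<Rightarrow> real"
  where "combined_objective G OD \<tau> \<gamma> =
    (\<lambda>(f, x, d). flow_potential G \<tau> f + \<gamma> * entropy_term OD d)"

end

theory Submission
  imports Defs
begin

text \<open>
  The potential of the edge flows is convex with gradient \<open>t(f)\<close>, so both blocks and \<open>(\<ast>)\<close>
  can be compared through the linear functional \<open>f' \<mapsto> \<langle>t(f), f'\<rangle>\<close>. For a flow \<open>f'\<close> carrying the demand
  \<open>d'\<close> its value is at least \<open>\<langle>T(t(f)), d'\<rangle>\<close>, and all-or-nothing assignment to shortest paths attains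
  this bound. Hence a flow \<open>f\<close> that is optimal for \<open>d\<close> satisfies \<open>\<langle>t(f), f\<rangle> = \<langle>T(t(f)), d\<rangle>\<close>
  (Wardrop). Given this, the subgradient inequality turns an equilibrium into an optimum of \<open>(\<ast>)\<close>.
  Conversely, one moves from an optimum of \<open>(\<ast>)\<close> towards an all-or-nothing assignment of another
  demand and differentiates the flow potential only: for the entropy, convexity along the segment
  suffices, so the infinite slope of \<open>y ln y\<close> at \<open>0\<close> does no harm.
\<close>

section \<open>Convexity on the real line\<close>

text \<open>The tangent at an interior point \<open>z\<close> supports the function on the whole
  closed half-line, including 0, where no derivative is available; averaging two tangent
  inequalities gives convexity.\<close>

lemma convex_on_mult_ln: "convex_on {0..} (\<lambda>x::real. x * ln x)"
proof (intro convex_onI)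
  fix t x y :: real
  assume t: "0 < t" "t < 1" and "x \<in> {0..}" "y \<in> {0..}"
  then have xy: "0 \<le> x" "0 \<le> y" by auto
  define z where "z = (1 - t) * x + t * y"
  \<comment> \<open>This is \<open>ln (z / a) \<le> z / a - 1\<close> multiplied by
    \<open>a\<close>; at \<open>a = 0\<close> it reduces to \<open>- z \<le> 0\<close>.\<close>
  have tangent: "z * ln z + (ln z + 1) * (a - z) \<le> a * ln a" if "0 < z" "0 \<le> a" for a
  proof (cases "a = 0")
    case False
    with that have "0 < a" by simp
    with that have "ln (z / a) \<le> z / a - 1" by (intro ln_le_minus_one) simp
    with \<open>0 < a\<close> \<open>0 < z\<close> have "a * (ln z - ln a) \<le> a * (z / a - 1)"
      by (intro mult_left_mono) (simp_all add: ln_div)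
    with \<open>0 < a\<close> show ?thesis by (simp add: algebra_simps)
  qed (use that in \<open>simp add: algebra_simps\<close>)
  have "z * ln z \<le> (1 - t) * (x * ln x) + t * (y * ln y)"
  proof (cases "z = 0")
    case True
    with t xy have "x = 0" "y = 0"
      unfolding z_def by (auto simp: add_nonneg_eq_0_iff)
    with True show ?thesis by simp
  next
    case False
    with t xy have "0 < z" unfolding z_def by (simp add: less_le)
    then have "(1 - t) * (z * ln z + (ln z + 1) * (x - z)) + t * (z * ln z + (ln z + 1) * (y - z))
        \<le> (1 - t) * (x * ln x) + t * (y * ln y)"
      using t xy by (intro add_mono mult_left_mono tangent) auto
    moreover have "(1 - t) * (z * ln z + (ln z + 1) * (x - z)) + t * (z * ln z + (ln z + 1) * (y - z))
        = z * ln z + (ln z + 1) * ((1 - t) * x + t * y - z)"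
      by (simp add: algebra_simps)
    ultimately show ?thesis by (simp add: z_def)
  qed
  then show "((1 - t) *\<^sub>R x + t *\<^sub>R y) * ln ((1 - t) *\<^sub>R x + t *\<^sub>R y)
      \<le> (1 - t) * (x * ln x) + t * (y * ln y)"
    by (simp add: z_def)
qed simp

text \<open>Between \<open>a\<close> and \<open>b\<close> monotonicity bounds \<open>g\<close> by
  \<open>g a\<close>, from below if \<open>a \<le> b\<close> and from above otherwise. Orientation
  turns both cases into one inequality: \<open>g a\<close> is a subgradient of the
  primitive.\<close>

lemma integral_mono_on_tangent:
  fixes g :: "real \<Rightarrow> real"
  assumes cont: "continuous_on {0..} g" and mono: "mono_on {0..} g" and "0 \<le> a" "0 \<le> b"
  shows "g a * (b - a) \<le> integral {0..b} g - integral {0..a} g"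
proof -
  have int: "g integrable_on {u..v}" if "0 \<le> u" for u v
    using that by (intro integrable_continuous_interval continuous_on_subset[OF cont]) auto
  show ?thesis
  proof (cases "a \<le> b")
    case True
    have "integral {a..b} (\<lambda>_. g a) \<le> integral {a..b} g"
      using assms by (intro integral_le int) (auto intro: mono_onD[OF mono])
    moreover have "integral {0..a} g + integral {a..b} g = integral {0..b} g"
      using True assms by (intro Henstock_Kurzweil_Integration.integral_combine int) auto
    ultimately show ?thesis using True by (simp add: algebra_simps)
  next
    case False
    have "integral {b..a} g \<le> integral {b..a} (\<lambda>_. g a)"
      using assms by (intro integral_le int) (auto intro: mono_onD[OF mono])
    moreover have "integral {0..b} g + integral {b..a} g = integral {0..a} g"
      using False assms by (intro Henstock_Kurzweil_Integration.integral_combine int) auto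
    ultimately show ?thesis using False by (simp add: algebra_simps)
  qed
qed

section \<open>Paths and path flows\<close>

text \<open>In a simple path each visited vertex but the last is the tail of an arc, and the last is
  the tail of none. So the end vertex survives forgetting the order of the arcs.\<close>

lemma (in wf_digraph) apath_last_unique:
  assumes "apath u p v"
  shows "insert u (head G ` set p) - tail G ` set p = {v}"
  using assms
proof (induction p arbitrary: u)
  case Nil
  then show ?case by (simp add: apath_Nil_iff)
next
  case (Cons e es)
  then have "tail G e = u" and tl: "apath (head G e) es v"
    and fresh: "u \<notin> set (awalk_verts (head G e) es)"
    by (auto simp: apath_Cons_iff)
  \<comment> \<open>Since \<open>u\<close> is never revisited, subtracting the tail \<open>u\<close>
    removes just the initial vertex.\<close>
  have "u \<notin> insert (head G e) (head G ` set es)"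
    using fresh tl by (auto simp: apath_def set_awalk_verts)
  with Cons.IH[OF tl] \<open>tail G e = u\<close> show ?case by auto
qed

text \<open>Gives disjointness of the path sets of different pairs, which splits sums over all paths
  into sums over pairs.\<close>

lemma (in wf_digraph) paths_determine_ends:
  assumes "p \<in> paths G i j" "p \<in> paths G i' j'"
  shows "i = i'" "j = j'"
proof -
  obtain q q' where "p = (i, set q)" "apath i q j" "p = (i', set q')" "apath i' q' j'"
    using assms by (auto simp: paths_def)
  with apath_last_unique[of i q j] apath_last_unique[of i' q' j']
  show "i = i'" "j = j'" by auto
qed

lemma (in fin_digraph) finite_paths: "finite (paths G i j)"
proof (rule finite_subset)
  show "paths G i j \<subseteq> {i} \<times> Pow (arcs G)"
    by (auto simp: paths_def apath_def awalk_def)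
qed simp

definition path_cost :: "('v, 'e) pre_digraph \<Rightarrow> ('e \<Rightarrow> real) \<Rightarrow> 'v \<times> 'e set \<Rightarrow> real"
  where "path_cost G t p = (\<Sum>e\<in>arcs G. incidence e p * t e)"

locale od_network = fin_digraph G for G :: "('v, 'e) pre_digraph" +
  fixes OD :: "('v \<times> 'v) set"
  assumes finite_OD: "finite OD"
    and paths_nonempty: "(i, j) \<in> OD \<Longrightarrow> paths G i j \<noteq> {}"
begin

section \<open>Path flows and shortest-path costs\<close>

lemma sum_all_paths:
  "(\<Sum>p\<in>all_paths G OD. g p) = (\<Sum>(i, j)\<in>OD. \<Sum>p\<in>paths G i j. g p)"
proof -
  have "(\<Sum>p\<in>(\<Union>k\<in>OD. paths G (fst k) (snd k)). g p)
      = (\<Sum>k\<in>OD. \<Sum>p\<in>paths G (fst k) (snd k). g p)"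
    using finite_OD by (intro sum.UNION_disjoint)
      (auto simp: finite_paths dest: paths_determine_ends)
  then show ?thesis by (simp add: all_paths_def case_prod_beta)
qed

lemma sum_flow_eq:
  assumes "(f, x) \<in> flow_assignments G OD d"
  shows "(\<Sum>e\<in>arcs G. t e * f e) = (\<Sum>(i, j)\<in>OD. \<Sum>p\<in>paths G i j. x p * path_cost G t p)"
proof -
  have "(\<Sum>e\<in>arcs G. t e * f e)
      = (\<Sum>e\<in>arcs G. \<Sum>p\<in>all_paths G OD. x p * (incidence e p * t e))"
    using assms by (intro sum.cong)
      (simp_all add: flow_assignments_def edge_flow_def sum_distrib_left mult_ac)
  also have "\<dots> = (\<Sum>p\<in>all_paths G OD. x p * path_cost G t p)"
    by (subst sum.swap) (simp add: path_cost_def sum_distrib_left)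
  finally show ?thesis by (simp add: sum_all_paths)
qed

lemma shortest_costs_eq: "shortest_costs G t (i, j) = Min (path_cost G t ` paths G i j)"
  by (simp add: shortest_costs_def path_cost_def[abs_def])

text \<open>Weak duality: the nonnegative flows on \<open>paths G i j\<close> add up to
  \<open>d (i, j)\<close>, and none of these paths is cheaper than the minimum.\<close>

lemma shortest_costs_le_flow_cost:
  assumes "(f, x) \<in> flow_assignments G OD d"
  shows "(\<Sum>(i, j)\<in>OD. d (i, j) * shortest_costs G t (i, j)) \<le> (\<Sum>e\<in>arcs G. t e * f e)"
  unfolding sum_flow_eq[OF assms]
proof (rule sum_mono, clarify)
  fix i j assume ij: "(i, j) \<in> OD"
  with assms have "d (i, j) = (\<Sum>p\<in>paths G i j. x p)"
    by (auto simp: flow_assignments_def path_flows_def)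
  then have "d (i, j) * shortest_costs G t (i, j)
      = (\<Sum>p\<in>paths G i j. x p * shortest_costs G t (i, j))"
    by (simp add: sum_distrib_right)
  also have "\<dots> \<le> (\<Sum>p\<in>paths G i j. x p * path_cost G t p)"
    using assms ij
    by (intro sum_mono mult_left_mono)
       (auto simp: shortest_costs_eq flow_assignments_def path_flows_def all_paths_def finite_paths)
  finally show "d (i, j) * shortest_costs G t (i, j)
      \<le> (\<Sum>p\<in>paths G i j. x p * path_cost G t p)" .
qed

text \<open>Sending each demand along one cheapest path makes the preceding bound tight; the costs
  \<open>t\<close> are frozen and do not react to the new flow.\<close>

lemma all_or_nothing_assignment:
  assumes nonneg: "\<forall>(i, j)\<in>OD. 0 \<le> d (i, j)"
  obtains f x where "(f, x) \<in> flow_assignments G OD d"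
    and "(\<Sum>e\<in>arcs G. t e * f e) = (\<Sum>(i, j)\<in>OD. d (i, j) * shortest_costs G t (i, j))"
proof -
  have "\<exists>p\<in>paths G i j. path_cost G t p = shortest_costs G t (i, j)" if "(i, j) \<in> OD" for i j
  proof -
    have "Min (path_cost G t ` paths G i j) \<in> path_cost G t ` paths G i j"
      using paths_nonempty[OF that] by (intro Min_in) (auto simp: finite_paths)
    then show ?thesis by (metis imageE shortest_costs_eq)
  qed
  then obtain q where q: "\<And>i j. (i, j) \<in> OD \<Longrightarrow> q i j \<in> paths G i j"
    "\<And>i j. (i, j) \<in> OD \<Longrightarrow> path_cost G t (q i j) = shortest_costs G t (i, j)"
    by metis
  \<comment> \<open>Chosen paths of different pairs differ, so at most one summand is in force for
    each \<open>p\<close>.\<close>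
  define x where "x p = (\<Sum>(i, j)\<in>OD. if p = q i j then d (i, j) else 0)" for p
  have x_eq: "x p = (if p = q i j then d (i, j) else 0)"
    if ij: "(i, j) \<in> OD" and p: "p \<in> paths G i j" for p i j
  proof -
    have "x p = (\<Sum>k\<in>OD. if k = (i, j) then if p = q i j then d (i, j) else 0 else 0)"
      unfolding x_def
    proof (rule sum.cong[OF refl], clarify)
      fix i' j' assume "(i', j') \<in> OD"
      then have "p \<noteq> q i' j'" if "(i', j') \<noteq> (i, j)"
        using that q(1)[of i' j'] paths_determine_ends[OF p, of i' j'] by metis
      then show "(if p = q i' j' then d (i', j') else 0)
          = (if (i', j') = (i, j) then if p = q i j then d (i, j) else 0 else 0)"
        by (cases "(i', j') = (i, j)") auto
    qed
    with ij show ?thesis by (simp add: finite_OD)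
  qed
  have "0 \<le> x p" for p
    unfolding x_def using nonneg by (auto intro!: sum_nonneg)
  moreover have "(\<Sum>p\<in>paths G i j. x p) = d (i, j)" if "(i, j) \<in> OD" for i j
    using that q(1) by (simp add: x_eq finite_paths)
  ultimately have fx: "(edge_flow G OD x, x) \<in> flow_assignments G OD d"
    by (auto simp: flow_assignments_def path_flows_def)
  have "(\<Sum>p\<in>paths G i j. x p * path_cost G t p) = d (i, j) * shortest_costs G t (i, j)"
    if "(i, j) \<in> OD" for i j
  proof -
    have "(\<Sum>p\<in>paths G i j. x p * path_cost G t p)
        = (\<Sum>p\<in>paths G i j. if p = q i j then d (i, j) * path_cost G t p else 0)"
      using that by (intro sum.cong) (simp_all add: x_eq)
    with that q show ?thesis by (simp add: finite_paths)
  qed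
  then have "(\<Sum>e\<in>arcs G. t e * edge_flow G OD x e)
      = (\<Sum>(i, j)\<in>OD. d (i, j) * shortest_costs G t (i, j))"
    unfolding sum_flow_eq[OF fx] by (intro sum.cong) auto
  with fx show thesis by (rule that)
qed

section \<open>Convex combinations of feasible points\<close>

lemma flow_assignments_nonneg:
  assumes "(f, x) \<in> flow_assignments G OD d" "e \<in> arcs G"
  shows "0 \<le> f e"
  using assms
  by (auto simp: flow_assignments_def path_flows_def edge_flow_def incidence_def intro!: sum_nonneg)

text \<open>The constraints are homogeneous and linear in \<open>f\<close>, \<open>x\<close>,
  \<open>d\<close> jointly, so the demand is averaged along with the flow.\<close>

lemma flow_assignments_combination:
  assumes "(f, x) \<in> flow_assignments G OD d" "(f', x') \<in> flow_assignments G OD d'"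
    and "0 \<le> u" "0 \<le> v"
  shows "(\<lambda>e. u * f e + v * f' e, \<lambda>p. u * x p + v * x' p)
    \<in> flow_assignments G OD (\<lambda>k. u * d k + v * d' k)"
proof -
  have "edge_flow G OD (\<lambda>p. u * x p + v * x' p) e
      = u * edge_flow G OD x e + v * edge_flow G OD x' e" for e
    by (simp add: edge_flow_def distrib_left mult.left_commute sum.distrib sum_distrib_left)
  moreover have "(\<lambda>p. u * x p + v * x' p) \<in> path_flows G OD (\<lambda>k. u * d k + v * d' k)"
    using assms
    by (fastforce simp: flow_assignments_def path_flows_def sum.distrib simp flip: sum_distrib_left)
  ultimately show ?thesis
    using assms by (simp add: flow_assignments_def)
qed

lemma demands_combination:
  assumes "d \<in> demands Orig Dest OD l w" "d' \<in> demands Orig Dest OD l w"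
    and "0 \<le> u" "0 \<le> v" "u + v = 1"
  shows "(\<lambda>k. u * d k + v * d' k) \<in> demands Orig Dest OD l w"
proof -
  have "u * a + v * a = a" for a
    using \<open>u + v = 1\<close> by (metis distrib_right mult_1)
  with assms show ?thesis
    by (fastforce simp: demands_def sum.distrib simp flip: sum_distrib_left)
qed

lemma combined_feasible_combination:
  assumes "(f, x, d) \<in> combined_feasible G Orig Dest OD l w"
    and "(f', x', d') \<in> combined_feasible G Orig Dest OD l w"
    and "0 \<le> u" "0 \<le> v" "u + v = 1"
  shows "(\<lambda>e. u * f e + v * f' e, \<lambda>p. u * x p + v * x' p, \<lambda>k. u * d k + v * d' k)
    \<in> combined_feasible G Orig Dest OD l w"
  using assms flow_assignments_combination demands_combination
  by (auto simp: combined_feasible_def)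

lemma entropy_term_combination:
  assumes "\<forall>(i, j)\<in>OD. 0 \<le> d (i, j)" "\<forall>(i, j)\<in>OD. 0 \<le> d' (i, j)"
    and "0 \<le> u" "0 \<le> v" "u + v = 1"
  shows "entropy_term OD (\<lambda>k. u * d k + v * d' k) \<le> u * entropy_term OD d + v * entropy_term OD d'"
proof -
  have eq: "entropy_term OD d = (\<Sum>k\<in>OD. d k * ln (d k))" for d
    by (simp add: entropy_term_def case_prod_beta)
  show ?thesis
    unfolding eq sum_distrib_left sum.distrib[symmetric]
    using assms convex_on_mult_ln by (intro sum_mono) (fastforce simp: convex_on_def)
qed

end

lemma real_fun_combination:
  fixes g h :: "'a \<Rightarrow> real"
  shows "u *\<^sub>R g + v *\<^sub>R h = (\<lambda>a. u * g a + v * h a)"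
  by (simp add: fun_eq_iff plus_fun_def scaleR_fun_def)

section \<open>Equilibria as optimal solutions\<close>

locale two_stage_network = od_network G OD
  for G :: "('v, 'e) pre_digraph" and OD :: "('v \<times> 'v) set" +
  fixes Orig Dest :: "'v set" and \<tau> :: "'e \<Rightarrow> real \<Rightarrow> real" and l w :: "'v \<Rightarrow> real" and \<gamma> :: real
  assumes cost_continuous: "e \<in> arcs G \<Longrightarrow> continuous_on {0..} (\<tau> e)"
    and cost_mono: "e \<in> arcs G \<Longrightarrow> mono_on {0..} (\<tau> e)"
    and gamma_pos: "\<gamma> > 0"
begin

abbreviation (input) "feasible \<equiv> combined_feasible G Orig Dest OD l w"
abbreviation (input) "objective \<equiv> combined_objective G OD \<tau> \<gamma>"
abbreviation (input) "travel_cost T d \<equiv> (\<Sum>(i, j)\<in>OD. d (i, j) * T (i, j))"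

section \<open>Tangents of the flow potential\<close>

lemma flow_potential_tangent:
  assumes "\<And>e. e \<in> arcs G \<Longrightarrow> 0 \<le> f e" "\<And>e. e \<in> arcs G \<Longrightarrow> 0 \<le> f' e"
  shows "(\<Sum>e\<in>arcs G. edge_costs \<tau> f e * (f' e - f e)) \<le> flow_potential G \<tau> f' - flow_potential G \<tau> f"
  \<comment> \<open>The potential is separable over arcs, so the one-dimensional subgradients add
    up.\<close>
  unfolding flow_potential_def edge_costs_def sum_subtractf[symmetric]
  using assms by (intro sum_mono integral_mono_on_tangent cost_continuous cost_mono) auto

text \<open>Averages the tangents at the intermediate flow \<open>g\<close> towards both ends; since
  \<open>u + v = 1\<close>, the linear parts cancel.\<close>

lemma flow_potential_combination:
  assumes f: "\<And>e. e \<in> arcs G \<Longrightarrow> 0 \<le> f e" and f': "\<And>e. e \<in> arcs G \<Longrightarrow> 0 \<le> f' e"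
    and uv: "0 \<le> u" "0 \<le> v" "u + v = 1"
  shows "flow_potential G \<tau> (\<lambda>e. u * f e + v * f' e)
    \<le> u * flow_potential G \<tau> f + v * flow_potential G \<tau> f'"
proof -
  define g where "g e = u * f e + v * f' e" for e
  have g: "0 \<le> g e" if "e \<in> arcs G" for e
    using f[OF that] f'[OF that] uv by (simp add: g_def)
  have "u * (\<Sum>e\<in>arcs G. edge_costs \<tau> g e * (f e - g e))
      + v * (\<Sum>e\<in>arcs G. edge_costs \<tau> g e * (f' e - g e))
      \<le> u * (flow_potential G \<tau> f - flow_potential G \<tau> g)
        + v * (flow_potential G \<tau> f' - flow_potential G \<tau> g)"
    using uv f f' g by (intro add_mono mult_left_mono flow_potential_tangent) auto
  moreover have "u * (\<Sum>e\<in>arcs G. edge_costs \<tau> g e * (f e - g e))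
      + v * (\<Sum>e\<in>arcs G. edge_costs \<tau> g e * (f' e - g e))
      = (\<Sum>e\<in>arcs G. edge_costs \<tau> g e * (g e - (u + v) * g e))"
    by (simp add: sum_distrib_left g_def algebra_simps flip: sum.distrib)
  moreover have "u * (flow_potential G \<tau> f - flow_potential G \<tau> g)
      + v * (flow_potential G \<tau> f' - flow_potential G \<tau> g)
      = u * flow_potential G \<tau> f + v * flow_potential G \<tau> f' - (u + v) * flow_potential G \<tau> g"
    by (simp add: algebra_simps)
  ultimately show ?thesis
    by (simp add: uv flip: g_def)
qed

text \<open>The tangent at the point \<open>F s\<close> of the segment, taken back to
  \<open>f\<close>, gives \<open>0 \<le> s * D s\<close>; dividing by \<open>s\<close> and letting
  \<open>s\<close> tend to 0 gives the claim. The constant \<open>c\<close> bounds the change of the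
  rest of the objective: 0 for a fixed demand, a scaled entropy difference for a varying
  one.\<close>

lemma flow_potential_first_order:
  assumes f: "\<And>e. e \<in> arcs G \<Longrightarrow> 0 \<le> f e" and f': "\<And>e. e \<in> arcs G \<Longrightarrow> 0 \<le> f' e"
    and min: "\<And>s. 0 < s \<Longrightarrow> s \<le> 1 \<Longrightarrow>
      flow_potential G \<tau> f \<le> flow_potential G \<tau> (\<lambda>e. (1 - s) * f e + s * f' e) + s * c"
  shows "0 \<le> (\<Sum>e\<in>arcs G. edge_costs \<tau> f e * (f' e - f e)) + c"
proof -
  define F where "F s e = (1 - s) * f e + s * f' e" for s e
  define D where "D s = (\<Sum>e\<in>arcs G. \<tau> e (F s e) * (f' e - f e)) + c" for s
  have F: "0 \<le> F s e" if "e \<in> arcs G" "0 \<le> s" "s \<le> 1" for s e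
    using f f' that by (simp add: F_def)
  have "0 \<le> D s" if s: "s \<in> {0<..1}" for s
  proof -
    have "(\<Sum>e\<in>arcs G. edge_costs \<tau> (F s) e * (f e - F s e))
        \<le> flow_potential G \<tau> f - flow_potential G \<tau> (F s)"
      using f F s by (intro flow_potential_tangent) auto
    moreover have "flow_potential G \<tau> f \<le> flow_potential G \<tau> (F s) + s * c"
      using min[of s] s by (simp add: F_def[abs_def])
    moreover have "(\<Sum>e\<in>arcs G. edge_costs \<tau> (F s) e * (f e - F s e)) = s * (c - D s)"
      by (simp add: D_def F_def edge_costs_def sum_distrib_left algebra_simps flip: sum_negf)
    ultimately have "0 \<le> s * D s"
      by (simp add: right_diff_distrib)
    with s show ?thesis by (simp add: zero_le_mult_iff)
  qed
  moreover have "continuous_on {0..1} D"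
    unfolding D_def
    by (intro continuous_intros continuous_on_compose2[OF cost_continuous])
      (auto simp: F F_def[abs_def] intro!: continuous_intros F[unfolded F_def])
  ultimately have "0 \<le> D 0"
    using continuous_ge_on_closure[of "{0<..1::real}" D 0 0] by simp
  then show ?thesis by (simp add: D_def F_def edge_costs_def)
qed

section \<open>Convexity of the combined problem\<close>

lemma convex_combined_feasible: "convex feasible"
  unfolding convex_def
  by (auto simp: real_fun_combination intro!: combined_feasible_combination)

lemma convex_on_combined_objective: "convex_on feasible objective"
  unfolding convex_on_def
proof (intro conjI convex_combined_feasible ballI allI impI)
  fix y y' and u v :: real
  assume y: "y \<in> feasible" "y' \<in> feasible" and uv: "0 \<le> u" "0 \<le> v" "u + v = 1"
  obtain f x d f' x' d' where eq: "y = (f, x, d)" "y' = (f', x', d')"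
    by (metis prod_cases3)
  have "flow_potential G \<tau> (\<lambda>e. u * f e + v * f' e)
      \<le> u * flow_potential G \<tau> f + v * flow_potential G \<tau> f'"
    using y uv
    by (intro flow_potential_combination)
      (auto simp: eq combined_feasible_def dest: flow_assignments_nonneg)
  moreover have "\<gamma> * entropy_term OD (\<lambda>k. u * d k + v * d' k)
      \<le> \<gamma> * (u * entropy_term OD d + v * entropy_term OD d')"
    using y uv gamma_pos
    by (intro mult_left_mono entropy_term_combination)
      (auto simp: eq combined_feasible_def demands_def)
  ultimately show "objective (u *\<^sub>R y + v *\<^sub>R y') \<le> u * objective y + v * objective y'"
    by (simp add: eq combined_objective_def real_fun_combination algebra_simps)
qed

section \<open>Equivalence of equilibria and optima\<close>

text \<open>Aggregated Wardrop principle: an all-or-nothing flow at the costs of \<open>f\<close>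
  carries the same demand, so moving towards it cannot lower the potential. The first-order
  condition with \<open>c = 0\<close> then bounds the cost of \<open>f\<close> by that of this
  cheapest flow.\<close>

lemma equilibrium_flow_cost:
  assumes opt: "is_arg_min (\<lambda>(f, x). flow_potential G \<tau> f)
      (\<lambda>(f, x). (f, x) \<in> flow_assignments G OD d) (f, x)"
    and d: "\<forall>(i, j)\<in>OD. 0 \<le> d (i, j)"
  shows "(\<Sum>e\<in>arcs G. edge_costs \<tau> f e * f e)
    = travel_cost (shortest_costs G (edge_costs \<tau> f)) d"
proof (rule antisym)
  let ?t = "edge_costs \<tau> f"
  have fx: "(f, x) \<in> flow_assignments G OD d"
    and le: "\<And>f' x'. (f', x') \<in> flow_assignments G OD d \<Longrightarrow> flow_potential G \<tau> f \<le> flow_potential G \<tau> f'"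
    using opt by (auto simp: is_arg_min_linorder)
  obtain f' x' where fx': "(f', x') \<in> flow_assignments G OD d"
    and cost: "(\<Sum>e\<in>arcs G. ?t e * f' e) = travel_cost (shortest_costs G ?t) d"
    using all_or_nothing_assignment[OF d] .
  have "0 \<le> (\<Sum>e\<in>arcs G. ?t e * (f' e - f e)) + 0"
  proof (rule flow_potential_first_order)
    fix s :: real assume s: "0 < s" "s \<le> 1"
    have "(\<lambda>e. (1 - s) * f e + s * f' e, \<lambda>p. (1 - s) * x p + s * x' p)
        \<in> flow_assignments G OD (\<lambda>k. (1 - s) * d k + s * d k)"
      using s by (intro flow_assignments_combination fx fx') auto
    then have "(\<lambda>e. (1 - s) * f e + s * f' e, \<lambda>p. (1 - s) * x p + s * x' p)
        \<in> flow_assignments G OD d"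
      by (simp add: algebra_simps)
    from le[OF this] show "flow_potential G \<tau> f
        \<le> flow_potential G \<tau> (\<lambda>e. (1 - s) * f e + s * f' e) + s * 0"
      by simp
  qed (use fx fx' in \<open>auto dest: flow_assignments_nonneg\<close>)
  then show "(\<Sum>e\<in>arcs G. ?t e * f e) \<le> travel_cost (shortest_costs G ?t) d"
    using cost by (simp add: right_diff_distrib sum_subtractf)
  show "travel_cost (shortest_costs G ?t) d \<le> (\<Sum>e\<in>arcs G. ?t e * f e)"
    using fx by (rule shortest_costs_le_flow_cost)
qed

text \<open>Towards a competitor the potential grows at least by its linearization at
  \<open>f\<close>, hence at least by the difference of shortest travel costs (Wardrop at
  \<open>d\<close>, weak duality at \<open>d'\<close>). This offsets any fall in entropy, as
  \<open>d\<close> minimizes the demand block.\<close>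

lemma equilibrium_imp_optimal:
  assumes dem: "is_entropy_demand Orig Dest OD l w \<gamma> (shortest_costs G (edge_costs \<tau> f)) d"
    and flow: "is_arg_min (\<lambda>(f, x). flow_potential G \<tau> f)
      (\<lambda>(f, x). (f, x) \<in> flow_assignments G OD d) (f, x)"
  shows "is_arg_min objective (\<lambda>y. y \<in> feasible) (f, x, d)"
proof -
  let ?t = "edge_costs \<tau> f"
  let ?T = "shortest_costs G ?t"
  have fx: "(f, x) \<in> flow_assignments G OD d" using flow by (simp add: is_arg_min_def)
  have d: "d \<in> demands Orig Dest OD l w"
    using dem by (simp add: is_entropy_demand_def is_arg_min_def)
  have "objective (f, x, d) \<le> objective (f', x', d')" if y': "(f', x', d') \<in> feasible" for f' x' d'
  proof -
    have fx': "(f', x') \<in> flow_assignments G OD d'" and d': "d' \<in> demands Orig Dest OD l w"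
      using y' by (auto simp: combined_feasible_def)
    have "travel_cost ?T d + \<gamma> * entropy_term OD d \<le> travel_cost ?T d' + \<gamma> * entropy_term OD d'"
      using dem d' by (simp add: is_entropy_demand_def is_arg_min_linorder)
    moreover have "travel_cost ?T d' \<le> (\<Sum>e\<in>arcs G. ?t e * f' e)"
      using fx' by (rule shortest_costs_le_flow_cost)
    moreover have "(\<Sum>e\<in>arcs G. ?t e * f e) = travel_cost ?T d"
      using d by (intro equilibrium_flow_cost[OF flow]) (simp add: demands_def)
    moreover have "(\<Sum>e\<in>arcs G. ?t e * (f' e - f e)) \<le> flow_potential G \<tau> f' - flow_potential G \<tau> f"
      using fx fx' by (intro flow_potential_tangent) (auto dest: flow_assignments_nonneg)
    ultimately show ?thesis
      by (simp add: combined_objective_def right_diff_distrib sum_subtractf)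
  qed
  then show ?thesis
    using fx d by (auto simp: is_arg_min_linorder combined_feasible_def)
qed

lemma optimal_imp_equilibrium:
  assumes opt: "is_arg_min objective (\<lambda>y. y \<in> feasible) (f, x, d)"
  shows "two_stage_equilibrium G Orig Dest OD \<tau> l w \<gamma> f d"
proof -
  let ?t = "edge_costs \<tau> f"
  let ?T = "shortest_costs G ?t"
  have y: "(f, x, d) \<in> feasible"
    and le: "\<And>y'. y' \<in> feasible \<Longrightarrow> objective (f, x, d) \<le> objective y'"
    using opt by (auto simp: is_arg_min_linorder)
  have fx: "(f, x) \<in> flow_assignments G OD d" and d: "d \<in> demands Orig Dest OD l w"
    using y by (auto simp: combined_feasible_def)
  \<comment> \<open>Competitors with the same \<open>d\<close> share the entropy term, so only
    potentials are compared.\<close>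
  have flow: "is_arg_min (\<lambda>(f, x). flow_potential G \<tau> f)
      (\<lambda>(f, x). (f, x) \<in> flow_assignments G OD d) (f, x)"
    using fx d le[of "(f', x', d)" for f' x']
    by (auto simp: is_arg_min_linorder combined_feasible_def combined_objective_def)
  have "travel_cost ?T d + \<gamma> * entropy_term OD d \<le> travel_cost ?T d' + \<gamma> * entropy_term OD d'"
    if d': "d' \<in> demands Orig Dest OD l w" for d'
  proof -
    have nonneg: "\<forall>(i, j)\<in>OD. 0 \<le> d (i, j)" "\<forall>(i, j)\<in>OD. 0 \<le> d' (i, j)"
      using d d' by (auto simp: demands_def)
    \<comment> \<open>Taking cheapest paths for the costs frozen at \<open>f\<close> makes the
      linearized cost equal to the travel cost of \<open>d'\<close> in the demand block.\<close>
    obtain f' x' where fx': "(f', x') \<in> flow_assignments G OD d'"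
      and cost: "(\<Sum>e\<in>arcs G. ?t e * f' e) = travel_cost ?T d'"
      using all_or_nothing_assignment[OF nonneg(2)] .
    have y': "(f', x', d') \<in> feasible"
      using fx' d' by (simp add: combined_feasible_def)
    have "0 \<le> (\<Sum>e\<in>arcs G. ?t e * (f' e - f e)) + \<gamma> * (entropy_term OD d' - entropy_term OD d)"
    proof (rule flow_potential_first_order)
      fix s :: real assume s: "0 < s" "s \<le> 1"
      let ?F = "\<lambda>e. (1 - s) * f e + s * f' e"
      let ?d = "\<lambda>k. (1 - s) * d k + s * d' k"
      have "(?F, \<lambda>p. (1 - s) * x p + s * x' p, ?d) \<in> feasible"
        using s by (intro combined_feasible_combination y y') auto
      from le[OF this] have "flow_potential G \<tau> f + \<gamma> * entropy_term OD d
          \<le> flow_potential G \<tau> ?F + \<gamma> * entropy_term OD ?d"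
        by (simp add: combined_objective_def)
      \<comment> \<open>The chord of the entropy, scaled by \<open>\<gamma>\<close>, supplies the
        constant \<open>c\<close>.\<close>
      also have "\<dots> \<le> flow_potential G \<tau> ?F
          + \<gamma> * ((1 - s) * entropy_term OD d + s * entropy_term OD d')"
        using s gamma_pos nonneg by (intro add_left_mono mult_left_mono entropy_term_combination) auto
      finally show "flow_potential G \<tau> f
          \<le> flow_potential G \<tau> ?F + s * (\<gamma> * (entropy_term OD d' - entropy_term OD d))"
        by (simp add: algebra_simps)
    qed (use fx fx' in \<open>auto dest: flow_assignments_nonneg\<close>)
    moreover have "(\<Sum>e\<in>arcs G. ?t e * f e) = travel_cost ?T d"
      using flow nonneg(1) by (rule equilibrium_flow_cost)
    ultimately show ?thesis
      using cost by (simp add: right_diff_distrib sum_subtractf)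
  qed
  with d have "is_entropy_demand Orig Dest OD l w \<gamma> ?T d"
    by (simp add: is_entropy_demand_def is_arg_min_linorder)
  with flow show ?thesis
    by (auto simp: two_stage_equilibrium_def is_equilibrium_flow_def)
qed

end

theorem mainTheorem1:
  fixes G :: "('v, 'e) pre_digraph"
    and Orig Dest :: "'v set"
    and OD :: "('v \<times> 'v) set"
    and \<tau> :: "'e \<Rightarrow> real \<Rightarrow> real"
    and l w :: "'v \<Rightarrow> real"
    and \<gamma> :: real
  assumes graph: "fin_digraph G"
    and origins: "Orig \<subseteq> verts G"
    and destinations: "Dest \<subseteq> verts G"
    and pairs: "OD \<subseteq> Orig \<times> Dest"
    and paths_nonempty: "\<And>i j. (i, j) \<in> OD \<Longrightarrow> paths G i j \<noteq> {}"
    and cost_nonneg: "\<And>e z. e \<in> arcs G \<Longrightarrow> 0 \<le> z \<Longrightarrow> 0 \<le> \<tau> e z"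
    and cost_continuous: "\<And>e. e \<in> arcs G \<Longrightarrow> continuous_on {0..} (\<tau> e)"
    and cost_mono: "\<And>e. e \<in> arcs G \<Longrightarrow> mono_on {0..} (\<tau> e)"
    and l_nonneg: "\<And>i. i \<in> Orig \<Longrightarrow> 0 \<le> l i"
    and w_nonneg: "\<And>j. j \<in> Dest \<Longrightarrow> 0 \<le> w j"
    and l_total: "(\<Sum>i\<in>Orig. l i) = 1"
    and w_total: "(\<Sum>j\<in>Dest. w j) = 1"
    and gamma_pos: "\<gamma> > 0"
  shows "convex (combined_feasible G Orig Dest OD l w) \<and>
    convex_on (combined_feasible G Orig Dest OD l w) (combined_objective G OD \<tau> \<gamma>) \<and>
    (\<forall>f d. two_stage_equilibrium G Orig Dest OD \<tau> l w \<gamma> f d \<longleftrightarrow>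
      (\<exists>x. is_arg_min (combined_objective G OD \<tau> \<gamma>)
        (\<lambda>y. y \<in> combined_feasible G Orig Dest OD l w) (f, x, d)))"
proof -
  interpret fin_digraph G by (fact graph)
  have "finite OD"
    using origins destinations pairs by (intro finite_subset[of OD "verts G \<times> verts G"]) auto
  then interpret two_stage_network G OD Orig Dest \<tau> l w \<gamma>
    using paths_nonempty cost_continuous cost_mono gamma_pos by unfold_locales
  \<comment> \<open>A path flow solving the flow block also serves as the \<open>x\<close> of the
    combined optimum.\<close>
  show ?thesis
    using convex_combined_feasible convex_on_combined_objective equilibrium_imp_optimal
      optimal_imp_equilibrium
    by (auto simp: two_stage_equilibrium_def is_equilibrium_flow_def)
qed

end
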